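(* Let $d$ be a fixed positive integer. Then there exist a template $T$ over the alphabet $[3]=\{1,2,3\}$, and a colouring with finitely many colours of the set $\bigcup_{n\ge 1}[3]^n$ of all finite length words on alphabet $[3]$, such that, for every positive integer $n$, $[3]^n$ contains no monochromatic copy of $T$ (i.e. no monochromatic block set with template $T$) whose blocks all have size at most $d$.
   Context: Write $[m]=\{1,\dots,m\}$. A template over $[m]$ is a non-decreasing word $T\in[m]^l$ for some positive integer $l$. Let $S\subseteq[m]^l$ be the set of all words of length $l$ on alphabet $[m]$ that are permutations (rearrangements of the letters) of $T$. A block set with template $T$ in $[m]^n$ (also called a copy of $T$) is a set $B\subseteq[m]^n$ formed as follows: select pairwise disjoint nonempty sets $I_1,\dots,I_l\subseteq[n]$ (the blocks), all of the same size, and fixed values $a_i\in[m]$ for each $i\in[n]\setminus\bigcup_j I_j$; then $B$ consists of all words $w\in[m]^n$ such that $w_i=a_i$ for all $i\notin\bigcup_j I_j$ and there exists $v\in S$ with $w_i=v_j$ whenever $i\in I_j$. The common size of the blocks $I_j$ is called the block size, or degree, of the block set. A block set is monochromatic for a colouring if all its words receive the same colour. *)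

theory Defs
  imports "HOL-Library.Multiset" "HOL-Library.FuncSet" "HOL-Library.Disjoint_Sets"
begin

(* Letters are 1, ..., m; positions in a word of length n, and the indices of the blocks,
   are numbered from 0, as is usual for lists. *)

definition words :: "nat \<Rightarrow> nat \<Rightarrow> nat list set" where
  "words m n = {w. length w = n \<and> set w \<subseteq> {1..m}}"

definition is_template :: "nat \<Rightarrow> nat list \<Rightarrow> bool" where
  "is_template m T \<longleftrightarrow> (\<exists>l\<ge>1. T \<in> words m l) \<and> sorted T"

definition rearrangements :: "nat \<Rightarrow> nat list \<Rightarrow> nat list set" where
  "rearrangements m T = {v \<in> words m (length T). mset v = mset T}"

definition block_set ::
    "nat \<Rightarrow> nat list \<Rightarrow> nat \<Rightarrow> (nat \<Rightarrow> nat set) \<Rightarrow> (nat \<Rightarrow> nat) \<Rightarrow> nat list set" where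
  "block_set m T n I a =
     {w \<in> words m n.
        (\<forall>i \<in> {..<n} - (\<Union>j<length T. I j). w ! i = a i) \<and>
        (\<exists>v \<in> rearrangements m T. \<forall>j<length T. \<forall>i \<in> I j. w ! i = v ! j)}"

(* The block size k is a parameter of a relation, not a function of B: when all letters of T
   coincide, the same set B arises from blocks of different sizes. *)
definition is_block_set :: "nat \<Rightarrow> nat list \<Rightarrow> nat \<Rightarrow> nat \<Rightarrow> nat list set \<Rightarrow> bool" where
  "is_block_set m T n k B \<longleftrightarrow>
     (\<exists>I a. (\<forall>j<length T. I j \<subseteq> {..<n} \<and> I j \<noteq> {} \<and> card (I j) = k) \<and>
            disjoint_family_on I {..<length T} \<and>
            (\<forall>i \<in> {..<n} - (\<Union>j<length T. I j). a i \<in> {1..m}) \<and>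
            B = block_set m T n I a)"

definition monochromatic :: "('a \<Rightarrow> 'c) \<Rightarrow> 'a set \<Rightarrow> bool" where
  "monochromatic c B \<longleftrightarrow> (\<forall>x\<in>B. \<forall>y\<in>B. c x = c y)"

end

theory Submission
  imports Defs "HOL-Library.Ramsey" "HOL-Number_Theory.Cong"
begin

text \<open>
  Let \<open>p > d\<close> be prime and colour \<open>w\<close> by the sum, over the positions \<open>q\<close> carrying a 2, of the
  \<open>(p - 1)\<close>-st power of the number of 1s after \<open>q\<close>, modulo \<open>p\<close>. The template consists of \<open>p - 1\<close>
  ones, a single 2 and many 3s.

  Let the blocks have size \<open>k\<close>, and let \<open>h i q\<close> be the number of elements of block \<open>i\<close> after \<open>q\<close>.
  On a monochromatic copy, moving the 2 between blocks \<open>b\<close> and \<open>b'\<close> (exchanging it with a 3) does not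
  change the colour. Taking alternating sums over exchanges of the 1s in blocks \<open>i\<^sub>s\<close> with 3s in blocks
  \<open>j\<^sub>s\<close>, for \<open>s < p - 1\<close>, only the top-degree part of the power survives, so that modulo \<open>p\<close> the sum of
  \<open>\<Prod>s. (h i\<^sub>s q - h j\<^sub>s q)\<close> over the positions \<open>q\<close> in block \<open>b\<close> does not depend on \<open>b\<close>.

  For a set \<open>K\<close> of \<open>p\<close> blocks and \<open>b\<close> in \<open>K\<close>, the sum \<open>F K b\<close> of \<open>\<Prod>i\<in>K - {b}. h i q\<close> over \<open>q\<close> in
  block \<open>b\<close> counts the ways to choose one position in each block of \<open>K\<close> such that the first one lies in
  block \<open>b\<close>; summed over \<open>b\<close> it is therefore \<open>k ^ p\<close>. By Ramsey's theorem we may assume that, modulo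
  \<open>p\<close>, \<open>F K b\<close> is a function \<open>g\<close> of the rank of \<open>b\<close> in \<open>K\<close>. If all \<open>i\<^sub>s\<close> precede \<open>b\<close>, which precedes
  all \<open>j\<^sub>s\<close>, which precede \<open>b'\<close>, then the alternating sum for \<open>b'\<close> vanishes, and the one for \<open>b\<close> is
  \<open>\<Sum>r<p. (-1) ^ r * (p - 1 choose r) * g (p - 1 - r)\<close>. Since \<open>(-1) ^ r * (p - 1 choose r)\<close> is 1 modulo
  \<open>p\<close>, the latter is \<open>\<Sum>r<p. g r\<close>, that is \<open>k ^ p\<close>. So \<open>p\<close> divides \<open>k ^ p\<close>, although
  \<open>0 < k \<le> d < p\<close>.
\<close>

hide_const (open) Ramsey.monochromatic

section \<open>Alternating sums, binomials modulo a prime, and counting choices\<close>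

lemma sum_Pow_insert:
  assumes "finite S" "s \<notin> S"
  shows "(\<Sum>R\<in>Pow (insert s S). f R) = (\<Sum>R\<in>Pow S. f R) + (\<Sum>R\<in>Pow S. f (insert s R))"
proof -
  have "inj_on (insert s) (Pow S)"
    using assms(2) by (auto simp: inj_on_def)
  moreover have "Pow S \<inter> insert s ` Pow S = {}"
    using assms(2) by auto
  ultimately show ?thesis
    using assms(1) by (simp add: Pow_insert sum.union_disjoint sum.reindex)
qed

lemma sum_Pow_insert_alternating:
  fixes u :: "'a set \<Rightarrow> 'b::comm_ring_1"
  assumes "finite S" "s \<notin> S"
    and "\<And>R. R \<subseteq> S \<Longrightarrow> f R = u R" "\<And>R. R \<subseteq> S \<Longrightarrow> f (insert s R) = v R"
  shows "(\<Sum>R\<in>Pow (insert s S). (- 1) ^ card R * f R) = (\<Sum>R\<in>Pow S. (- 1) ^ card R * (u R - v R))"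
proof -
  have "card (insert s R) = Suc (card R)" if "R \<in> Pow S" for R
    using that assms(1,2) by (metis PowD card_insert_disjoint finite_subset subsetD)
  then show ?thesis
    using assms by (simp add: sum_Pow_insert right_diff_distrib flip: sum_subtractf sum.distrib)
qed

lemma prod_diff_eq_alternating_sum:
  fixes x y :: "'a \<Rightarrow> 'b::comm_ring_1"
  assumes "finite S"
  shows "(\<Sum>R\<in>Pow S. (- 1) ^ card R * (\<Prod>s\<in>S. if s \<in> R then y s else x s)) = (\<Prod>s\<in>S. x s - y s)"
  using assms
proof (induction S rule: finite_induct)
  case (insert a S)
  have "(\<Sum>R\<in>Pow (insert a S). (- 1) ^ card R * (\<Prod>s\<in>insert a S. if s \<in> R then y s else x s)) =
      (\<Sum>R\<in>Pow S. (- 1) ^ card R * (x a * (\<Prod>s\<in>S. if s \<in> R then y s else x s) -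
        y a * (\<Prod>s\<in>S. if s \<in> R then y s else x s)))"
    using insert.hyps by (intro sum_Pow_insert_alternating) (auto intro!: arg_cong2[where f = times] prod.cong)
  also have "\<dots> = (x a - y a) * (\<Sum>R\<in>Pow S. (- 1) ^ card R * (\<Prod>s\<in>S. if s \<in> R then y s else x s))"
    by (simp add: sum_distrib_left algebra_simps)
  finally show ?case
    using insert by simp
qed auto

text \<open>This is an iterated finite difference, one difference for each element of
  \<open>S\<close>. Each lowers the degree of the power by one, so \<open>card S\<close> of them
  kill every lower degree and leave only the leading term; the offset \<open>c\<close>
  disappears.\<close>

lemma alternating_sum_power:
  fixes x y :: "'a \<Rightarrow> 'b::comm_ring_1"
  assumes "finite S" "m \<le> card S"
  shows "(\<Sum>R\<in>Pow S. (- 1) ^ card R * (c + (\<Sum>s\<in>S. if s \<in> R then y s else x s)) ^ m) =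
    (if m = card S then of_nat (fact m) * (\<Prod>s\<in>S. x s - y s) else 0)"
  using assms
proof (induction S arbitrary: m rule: finite_induct)
  case (insert a S)
  define U where "U R = c + (\<Sum>s\<in>S. if s \<in> R then y s else x s)" for R
  define V where "V j = (\<Sum>R\<in>Pow S. (- 1) ^ card R * U R ^ j)" for j
  have V: "V j = (if j = card S then of_nat (fact j) * (\<Prod>s\<in>S. x s - y s) else 0)" if "j \<le> card S" for j
    using insert.IH[OF that] by (simp add: V_def U_def)
  have "(\<Sum>R\<in>Pow (insert a S). (- 1) ^ card R * (c + (\<Sum>s\<in>insert a S. if s \<in> R then y s else x s)) ^ m) =
      (\<Sum>R\<in>Pow S. (- 1) ^ card R * ((U R + x a) ^ m - (U R + y a) ^ m))"
    using insert.hyps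
    by (intro sum_Pow_insert_alternating)
       (auto simp: U_def add_ac intro!: arg_cong[where f = "\<lambda>t. t ^ m"] arg_cong2[where f = plus] sum.cong)
  also have "\<dots> = (\<Sum>R\<in>Pow S. \<Sum>j\<le>m. of_nat (m choose j) * (x a ^ (m - j) - y a ^ (m - j)) * ((- 1) ^ card R * U R ^ j))"
    by (simp add: binomial_ring sum_distrib_left algebra_simps flip: sum_subtractf)
  also have "\<dots> = (\<Sum>j\<le>m. of_nat (m choose j) * (x a ^ (m - j) - y a ^ (m - j)) * V j)"
    by (subst sum.swap) (simp add: V_def sum_distrib_left)
  \<comment> \<open>The term \<open>j = m\<close> vanishes because both 0th powers are 1. The
    remaining exponents are at most \<open>card S\<close>, where \<open>V\<close> is known; only
    \<open>j = card S\<close> can contribute, and then \<open>m choose j = m\<close> completes the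
    factorial.\<close>
  also have "\<dots> = (\<Sum>j<m. of_nat (m choose j) * (x a ^ (m - j) - y a ^ (m - j)) * V j)"
    by (simp add: lessThan_Suc_atMost[symmetric])
  also have "\<dots> = (if m = card (insert a S) then of_nat (fact m) * (\<Prod>s\<in>insert a S. x s - y s) else 0)"
  proof (cases "m = Suc (card S)")
    case True
    have "(\<Sum>j<card S. of_nat (m choose j) * (x a ^ (m - j) - y a ^ (m - j)) * V j) = 0"
      by (intro sum.neutral) (auto simp: V)
    then show ?thesis
      using insert.hyps True by (simp add: V algebra_simps)
  next
    case False
    then have "V j = 0" if "j < m" for j
      using insert that by (simp add: V)
    then show ?thesis
      using insert.hyps False by simp
  qed
  finally show ?case .
qed auto

text \<open>By Pascal's rule, neighbouring coefficients in row \<open>p - 1\<close> add up to a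
  coefficient of row \<open>p\<close> that \<open>p\<close> divides, so they are negatives of each
  other modulo \<open>p\<close>.\<close>

lemma alternating_choose_prime_minus_1_cong:
  assumes "prime p" "r < p"
  shows "[(- 1) ^ r * int ((p - 1) choose r) = 1] (mod int p)"
  using assms(2)
proof (induction r)
  case (Suc r)
  have "p dvd (p choose Suc r)"
    using Suc.prems assms(1) by (intro dvd_choose_prime) auto
  moreover have "p choose Suc r = ((p - 1) choose r) + ((p - 1) choose Suc r)"
    using Suc.prems by (cases p) auto
  ultimately have "[int ((p - 1) choose r) + int ((p - 1) choose Suc r) = 0] (mod int p)"
    by (metis cong_0_iff int_dvd_int_iff of_nat_add)
  then have "[(- 1) ^ r * (int ((p - 1) choose r) + int ((p - 1) choose Suc r)) = (- 1) ^ r * 0] (mod int p)"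
    by (rule cong_scalar_left)
  with Suc have "[(- 1) ^ r * int ((p - 1) choose r) - (- 1) ^ r * (int ((p - 1) choose r) + int ((p - 1) choose Suc r)) = 1 - (- 1) ^ r * 0] (mod int p)"
    by (intro cong_diff) auto
  then show ?case
    by (simp add: algebra_simps)
qed auto

text \<open>The choice functions in \<open>Pi\<^sub>E K I\<close> are counted twice, on the left
  according to the block \<open>b\<close> and the position \<open>q\<close> of their least value.
  Disjointness of the blocks makes this minimum strict, hence \<open>b\<close> unique.\<close>

lemma sum_first_choice_eq_prod_card:
  fixes I :: "'i \<Rightarrow> 'a::linorder set"
  assumes "finite K" "K \<noteq> {}" "\<And>i. i \<in> K \<Longrightarrow> finite (I i)" "disjoint_family_on I K"
  shows "(\<Sum>b\<in>K. \<Sum>q\<in>I b. \<Prod>i\<in>K - {b}. card {r \<in> I i. q < r}) = (\<Prod>i\<in>K. card (I i))"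
proof -
  define P where "P b q = (\<Pi>\<^sub>E i\<in>K. if i = b then {q} else {r \<in> I i. q < r})" for b q
  have card_P: "card (P b q) = (\<Prod>i\<in>K - {b}. card {r \<in> I i. q < r})" if "b \<in> K" for b q
    unfolding P_def card_PiE[OF assms(1)] prod.remove[OF assms(1) that] by simp
  have P: "P b q = {f \<in> Pi\<^sub>E K I. f b = q \<and> (\<forall>i\<in>K - {b}. f b < f i)}" if "b \<in> K" "q \<in> I b" for b q
  proof (rule set_eqI)
    fix f
    have "(\<forall>i\<in>K. f i \<in> (if i = b then {q} else {r \<in> I i. q < r})) \<longleftrightarrow>
        (\<forall>i\<in>K. f i \<in> I i) \<and> f b = q \<and> (\<forall>i\<in>K - {b}. f b < f i)"
      using that by (smt (verit) DiffD1 DiffD2 DiffI mem_Collect_eq singletonD singletonI)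
    then show "f \<in> P b q \<longleftrightarrow> f \<in> {f \<in> Pi\<^sub>E K I. f b = q \<and> (\<forall>i\<in>K - {b}. f b < f i)}"
      unfolding P_def PiE_iff mem_Collect_eq by blast
  qed
  have "Pi\<^sub>E K I \<subseteq> (\<Union>b\<in>K. \<Union>q\<in>I b. P b q)"
  proof
    fix f assume f: "f \<in> Pi\<^sub>E K I"
    define b where "b = arg_min_on f K"
    have b: "b \<in> K" "\<And>i. i \<in> K \<Longrightarrow> f b \<le> f i"
      using assms(1,2) by (auto simp: b_def arg_min_if_finite arg_min_least)
    have "f i \<noteq> f b" if "i \<in> K" "i \<noteq> b" for i
      using f b(1) that assms(4) by (fastforce simp: disjoint_family_on_def)
    then have "f b < f i" if "i \<in> K" "i \<noteq> b" for i
      using that b(2) by (metis order_le_less)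
    then have "f \<in> P b (f b)"
      using f b(1) by (subst P) auto
    moreover have "f b \<in> I b"
      using f b(1) by (rule PiE_mem)
    ultimately show "f \<in> (\<Union>b\<in>K. \<Union>q\<in>I b. P b q)"
      using b(1) by (intro UN_I)
  qed
  moreover have "(\<Union>b\<in>K. \<Union>q\<in>I b. P b q) \<subseteq> Pi\<^sub>E K I"
    by (intro UN_least) (simp add: P)
  ultimately have "Pi\<^sub>E K I = (\<Union>b\<in>K. \<Union>q\<in>I b. P b q)"
    by (rule equalityI)
  moreover have fin: "finite (P b q)" if "b \<in> K" "q \<in> I b" for b q
    using that assms(1,3) by (simp add: P_def finite_PiE)
  moreover have "card (\<Union>b\<in>K. \<Union>q\<in>I b. P b q) = (\<Sum>b\<in>K. card (\<Union>q\<in>I b. P b q))"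
  proof (rule card_UN_disjoint)
    show "\<forall>b\<in>K. \<forall>b'\<in>K. b \<noteq> b' \<longrightarrow> (\<Union>q\<in>I b. P b q) \<inter> (\<Union>q\<in>I b'. P b' q) = {}"
      by (auto simp: P disjoint_iff) (metis DiffI less_asym singletonD)
  qed (use assms(1,3) fin in auto)
  moreover have "card (\<Union>q\<in>I b. P b q) = (\<Sum>q\<in>I b. card (P b q))" if "b \<in> K" for b
  proof (rule card_UN_disjoint)
    show "\<forall>q\<in>I b. \<forall>q'\<in>I b. q \<noteq> q' \<longrightarrow> P b q \<inter> P b q' = {}"
      using that by (simp add: P disjoint_iff)
  qed (use assms(3) fin that in auto)
  moreover have "card (Pi\<^sub>E K I) = (\<Prod>i\<in>K. card (I i))"
    using assms(1) by (simp add: card_PiE)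
  ultimately show ?thesis
    by (simp add: card_P)
qed

section \<open>Ramsey's theorem and dependence on ranks only\<close>

lemma inj_on_card_less:
  fixes K :: "'a::linorder set"
  assumes "finite K"
  shows "inj_on (\<lambda>b. card {x \<in> K. x < b}) K"
proof (rule linorder_inj_onI)
  fix b b' assume "b < b'" "b \<in> K" "b' \<in> K"
  then have "{x \<in> K. x < b} \<subset> {x \<in> K. x < b'}"
    by auto
  then have "card {x \<in> K. x < b} < card {x \<in> K. x < b'}"
    using assms by (intro psubset_card_mono) auto
  then show "card {x \<in> K. x < b} \<noteq> card {x \<in> K. x < b'}"
    by simp
qed auto

text \<open>A \<open>p\<close>-set \<open>K\<close> is coloured by the whole table of its values
  \<open>F K b\<close>, indexed by rank. The number of possible tables depends only on
  \<open>p\<close> and \<open>q\<close>, so \<open>N\<close> can be fixed before \<open>F\<close>;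
  this allows the template to be chosen before the copy.\<close>

lemma ramsey_rank:
  obtains N :: nat where
    "\<And>F :: nat set \<Rightarrow> nat \<Rightarrow> nat. (\<And>K b. F K b < q) \<Longrightarrow>
      \<exists>H g. H \<subseteq> {..<N} \<and> card H = M \<and>
        (\<forall>K b. K \<subseteq> H \<longrightarrow> card K = p \<longrightarrow> b \<in> K \<longrightarrow> F K b = g (card {x \<in> K. x < b}))"
proof -
  define C where "C = Pow ({..<p} \<times> {..<q})"
  have "finite C"
    by (simp add: C_def)
  then obtain e where e: "bij_betw e C {0..<card C}"
    using ex_bij_betw_finite_nat by blast
  obtain N :: nat where N: "partn_lst {..<N} (replicate (card C) M) p"
    using ramsey_full by blast
  show thesis
  proof (rule that[of N])
    fix F :: "nat set \<Rightarrow> nat \<Rightarrow> nat"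
    assume F: "\<And>K b. F K b < q"
    define rk where "rk K b = card {x \<in> K. x < b}" for K and b :: nat
    \<comment> \<open>As ranks are distinct within \<open>K\<close>, this set of pairs is the graph
      of a function from ranks to values.\<close>
    define vec where "vec K = (\<lambda>b. (rk K b, F K b)) ` K" for K
    have rk: "rk K b < card K" if "finite K" "b \<in> K" for K b
      unfolding rk_def using that by (intro psubset_card_mono) auto
    have vec: "vec K \<in> C" if "K \<in> nsets {..<N} p" for K
      using that rk F by (auto simp: vec_def C_def nsets_def)
    then have "e (vec K) < card C" if "K \<in> nsets {..<N} p" for K
      using that e by (metis atLeastLessThan_iff bij_betwE)
    then have "(\<lambda>K. e (vec K)) \<in> nsets {..<N} p \<rightarrow> {..<card C}"
      by auto
    then obtain i H where H: "i < card C" "H \<in> nsets {..<N} (replicate (card C) M ! i)"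
        "(\<lambda>K. e (vec K)) ` nsets H p \<subseteq> {i}"
      by (rule partn_lstE[OF N]) auto
    have H': "H \<subseteq> {..<N}" "card H = M" "finite H"
      using H(1,2) by (auto simp: nsets_def)
    have vec_eq: "vec K = vec K'" if "K \<in> nsets H p" "K' \<in> nsets H p" for K K'
    proof -
      have "e (vec K) = e (vec K')" "vec K \<in> C" "vec K' \<in> C"
        using that H(3) H'(1) vec nsets_mono by blast+
      then show ?thesis
        using e by (auto simp: bij_betw_def inj_on_def)
    qed
    have F_eq: "F K b = F K' b'"
      if K: "K \<in> nsets H p" "K' \<in> nsets H p" "b \<in> K" "b' \<in> K'" "rk K b = rk K' b'" for K K' b b'
    proof -
      have "(rk K b, F K b) \<in> vec K'"
        unfolding vec_eq[OF K(1,2), symmetric] using K(3) by (simp add: vec_def)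
      then obtain b'' where b'': "b'' \<in> K'" "rk K' b'' = rk K b" "F K' b'' = F K b"
        by (auto simp: vec_def)
      moreover have "b'' = b'"
        using b'' K inj_on_card_less[of K'] by (auto simp: nsets_def inj_on_def rk_def)
      ultimately show ?thesis
        by simp
    qed
    define g where "g r = (SOME t. \<exists>K b. K \<in> nsets H p \<and> b \<in> K \<and> rk K b = r \<and> F K b = t)" for r
    have "F K b = g (rk K b)" if "K \<in> nsets H p" "b \<in> K" for K b
    proof -
      have "\<exists>K' b'. K' \<in> nsets H p \<and> b' \<in> K' \<and> rk K' b' = rk K b \<and> F K' b' = g (rk K b)"
        unfolding g_def by (rule someI_ex) (use that in blast)
      then show ?thesis
        using that F_eq by metis
    qed
    then have "\<forall>K b. K \<subseteq> H \<longrightarrow> card K = p \<longrightarrow> b \<in> K \<longrightarrow> F K b = g (rk K b)"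
      using H'(3) finite_subset by (auto simp: nsets_def)
    with H' show "\<exists>H g. H \<subseteq> {..<N} \<and> card H = M \<and>
        (\<forall>K b. K \<subseteq> H \<longrightarrow> card K = p \<longrightarrow> b \<in> K \<longrightarrow> F K b = g (card {x \<in> K. x < b}))"
      unfolding rk_def by blast
  qed
qed

section \<open>Divisibility of a power of the block size by the prime\<close>

lemma prime_dvd_block_size_power:
  fixes I :: "nat \<Rightarrow> nat set" and c :: "nat \<Rightarrow> nat" and g :: "nat \<Rightarrow> nat"
  assumes p: "prime p" and H: "card H = 2 * p"
    and I: "\<And>i. i \<in> H \<Longrightarrow> finite (I i)" "\<And>i. i \<in> H \<Longrightarrow> card (I i) = k" "disjoint_family_on I H"
    and hom: "\<And>K b. \<lbrakk>K \<subseteq> H; card K = p; b \<in> K\<rbrakk> \<Longrightarrow>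
      [(\<Sum>q\<in>I b. \<Prod>i\<in>K - {b}. card {r \<in> I i. q < r}) = g (card {x \<in> K. x < b})] (mod p)"
    and indep: "\<And>A b b'. \<lbrakk>A \<subseteq> H; card A = p - 1; b \<in> H - A; b' \<in> H - A\<rbrakk> \<Longrightarrow>
      [(\<Sum>q\<in>I b. (c q + (\<Sum>i\<in>A. card {r \<in> I i. q < r})) ^ (p - 1)) =
       (\<Sum>q\<in>I b'. (c q + (\<Sum>i\<in>A. card {r \<in> I i. q < r})) ^ (p - 1))] (mod p)"
  shows "p dvd k ^ p"
proof -
  \<comment> \<open>\<open>hom\<close> is what Ramsey's theorem provides. \<open>indep\<close> is
    what monochromaticity provides, with \<open>c q\<close> standing for the number of fixed 1s
    after \<open>q\<close>.\<close>
  define m where "m = p - 1"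
  have pm: "p = Suc m" and "m \<noteq> 0"
    using prime_gt_1_nat[OF p] by (auto simp: m_def)
  have finH: "finite H"
    using H pm by (intro card_ge_0_finite) simp
  define e where "e = (!) (sorted_list_of_set H)"
  have e_less: "e s < e t" if "s < t" "t < 2 * p" for s t
    using that H finH sorted_wrt_nth_less[OF strict_sorted_list_of_set[of H]] by (simp add: e_def)
  have e_inj: "e s = e t \<longleftrightarrow> s = t" if "s < 2 * p" "t < 2 * p" for s t
    using that e_less by (metis nat_neq_iff)
  have e_less_iff: "e s < e t \<longleftrightarrow> s < t" if "s < 2 * p" "t < 2 * p" for s t
    using that e_less by (metis nat_neq_iff order_less_asym)
  have eH: "e s \<in> H" if "s < 2 * p" for s
    using that H finH nth_mem[of s "sorted_list_of_set H"] by (simp add: e_def)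
  define h where "h i q = card {r \<in> I i. q < r}" for i q
  define F where "F A b = (\<Sum>q\<in>I b. \<Prod>i\<in>A. h i q)" for A b

  \<comment> \<open>In increasing order, the \<open>2 * p\<close> blocks of \<open>H\<close> serve
    as follows: \<open>e s\<close> with \<open>s < m\<close> are the initial places of the 1s,
    \<open>e m\<close> is the first place of the 2, \<open>e (p + s)\<close> are the places
    exchanged with \<open>e s\<close>, and the last block \<open>e (p + m)\<close> is the other
    place of the 2. \<open>A R\<close> holds the 1s after the exchanges in \<open>R\<close>.\<close>
  define \<phi> where "\<phi> R s = (if s \<in> R then e (p + s) else e s)" for R s
  define A where "A R = \<phi> R ` {..<m}" for R
  define G where "G b = (\<Sum>R\<in>Pow {..<m}. (- 1) ^ card R * int (F (A R) b))" for b
  have \<phi>_inj: "inj_on (\<phi> R) {..<m}" for R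
    by (auto simp: inj_on_def \<phi>_def e_inj pm split: if_splits)
  have A: "A R \<subseteq> H" "card (A R) = m" "e m \<notin> A R" "e (p + m) \<notin> A R" "finite (A R)" for R
    using card_image[OF \<phi>_inj] by (auto simp: A_def \<phi>_def e_inj pm eH split: if_splits)

  \<comment> \<open>The alternating sum turns the powers into \<open>fact m\<close> times a product
    of differences, which is then expanded again into products over the sets
    \<open>A R\<close>.\<close>
  have G: "(\<Sum>R\<in>Pow {..<m}. (- 1) ^ card R * int (\<Sum>q\<in>I b. (c q + (\<Sum>i\<in>A R. h i q)) ^ m)) =
      of_nat (fact m) * G b" for b
  proof -
    have pow: "(\<Sum>i\<in>A R. int (h i q)) = (\<Sum>s<m. if s \<in> R then int (h (e (p + s)) q) else int (h (e s) q))" for R q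
      unfolding A_def by (subst sum.reindex[OF \<phi>_inj]) (auto simp: \<phi>_def intro!: sum.cong)
    have prd: "(\<Prod>i\<in>A R. int (h i q)) = (\<Prod>s<m. if s \<in> R then int (h (e (p + s)) q) else int (h (e s) q))" for R q
      unfolding A_def by (subst prod.reindex[OF \<phi>_inj]) (auto simp: \<phi>_def intro!: prod.cong)
    have "(\<Sum>R\<in>Pow {..<m}. (- 1) ^ card R * int (\<Sum>q\<in>I b. (c q + (\<Sum>i\<in>A R. h i q)) ^ m)) =
      (\<Sum>q\<in>I b. \<Sum>R\<in>Pow {..<m}. (- 1) ^ card R *
        (int (c q) + (\<Sum>s<m. if s \<in> R then int (h (e (p + s)) q) else int (h (e s) q))) ^ m)"
      by (subst sum.swap) (simp add: sum_distrib_left pow)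
    also have "\<dots> = (\<Sum>q\<in>I b. of_nat (fact m) * (\<Prod>s<m. int (h (e s) q) - int (h (e (p + s)) q)))"
      by (simp add: alternating_sum_power)
    also have "\<dots> = (\<Sum>q\<in>I b. of_nat (fact m) * (\<Sum>R\<in>Pow {..<m}. (- 1) ^ card R * (\<Prod>i\<in>A R. int (h i q))))"
      by (simp only: prd prod_diff_eq_alternating_sum[OF finite_lessThan])
    also have "\<dots> = of_nat (fact m) * (\<Sum>q\<in>I b. \<Sum>R\<in>Pow {..<m}. (- 1) ^ card R * (\<Prod>i\<in>A R. int (h i q)))"
      by (simp only: sum_distrib_left)
    also have "\<dots> = of_nat (fact m) * G b"
      unfolding G_def F_def by (subst sum.swap) (simp add: sum_distrib_left)
    finally show ?thesis .
  qed
  have "[of_nat (fact m) * G (e m) = of_nat (fact m) * G (e (p + m))] (mod int p)"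
    unfolding G[symmetric]
  proof (intro cong_sum cong_scalar_left)
    fix R
    show "[int (\<Sum>q\<in>I (e m). (c q + (\<Sum>i\<in>A R. h i q)) ^ m) =
        int (\<Sum>q\<in>I (e (p + m)). (c q + (\<Sum>i\<in>A R. h i q)) ^ m)] (mod int p)"
      unfolding cong_int_iff using indep[of "A R" "e m" "e (p + m)"] A[of R] eH by (simp add: pm h_def)
  qed
  \<comment> \<open>Since \<open>m < p\<close>, the factor \<open>fact m\<close> can be cancelled
    modulo \<open>p\<close>.\<close>
  moreover have "coprime (int (fact m)) (int p)"
  proof -
    have "\<not> p dvd fact m"
      using p by (simp add: prime_dvd_fact_iff pm)
    then show ?thesis
      using p by (metis coprime_commute coprime_int_iff prime_imp_coprime)
  qed
  ultimately have G_eq: "[G (e m) = G (e (p + m))] (mod int p)"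
    by (simp only: cong_mult_lcancel)

  \<comment> \<open>All of \<open>A R\<close> precedes the last block, whose rank is therefore
    \<open>m\<close> whatever \<open>R\<close> is.\<close>
  have rank_last: "[int (F (A R) (e (p + m))) = int (g m)] (mod int p)" for R
  proof -
    have "{x \<in> insert (e (p + m)) (A R). x < e (p + m)} = A R"
      by (auto simp: A_def \<phi>_def e_less_iff pm)
    then show ?thesis
      unfolding cong_int_iff using hom[of "insert (e (p + m)) (A R)" "e (p + m)"] A[of R] eH pm
      by (simp add: F_def h_def)
  qed
  have "[G (e (p + m)) = (\<Sum>R\<in>Pow {..<m}. (- 1) ^ card R * int (g m))] (mod int p)"
    unfolding G_def by (intro cong_sum cong_scalar_left rank_last)
  \<comment> \<open>Exponent 0 makes every power equal to 1, and \<open>0 < m\<close> puts this in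
    the vanishing case.\<close>
  moreover have "(\<Sum>R\<in>Pow {..<m}. (- 1) ^ card R * int (g m)) = 0"
    using alternating_sum_power[of "{..<m}" 0 0 "\<lambda>_. 0" "\<lambda>_. 0 :: int"] \<open>m \<noteq> 0\<close>
    by (simp flip: sum_distrib_right)
  ultimately have G_last: "[G (e (p + m)) = 0] (mod int p)"
    by simp

  \<comment> \<open>Each exchange moves one block from before \<open>e m\<close> to after it,
    lowering the rank of \<open>e m\<close> by one.\<close>
  have rank_mid: "[int (F (A R) (e m)) = int (g (m - card R))] (mod int p)" if R: "R \<subseteq> {..<m}" for R
  proof -
    have "{x \<in> insert (e m) (A R). x < e m} = e ` ({..<m} - R)"
      by (auto simp: A_def \<phi>_def e_less_iff pm split: if_splits)
    moreover have "inj_on e ({..<m} - R)"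
      by (auto simp: inj_on_def e_inj pm)
    ultimately have "card {x \<in> insert (e m) (A R). x < e m} = m - card R"
      using R by (simp add: card_image card_Diff_subset finite_subset)
    then show ?thesis
      unfolding cong_int_iff using hom[of "insert (e m) (A R)" "e m"] A[of R] eH pm
      by (simp add: F_def h_def)
  qed
  have "[G (e m) = (\<Sum>R\<in>Pow {..<m}. (- 1) ^ card R * int (g (m - card R)))] (mod int p)"
    unfolding G_def by (intro cong_sum cong_scalar_left rank_mid) auto
  also have "(\<Sum>R\<in>Pow {..<m}. (- 1) ^ card R * int (g (m - card R))) =
      (\<Sum>r\<le>m. \<Sum>R\<in>{R \<in> Pow {..<m}. card R = r}. (- 1) ^ card R * int (g (m - card R)))"
    by (rule sum.group[symmetric]) (auto intro: card_mono[of "{..<m}", simplified])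
  also have "\<dots> = (\<Sum>r\<le>m. (- 1) ^ r * int (m choose r) * int (g (m - r)))"
    by (intro sum.cong) (auto simp: n_subsets[of "{..<m}", simplified])
  also have "[\<dots> = (\<Sum>r\<le>m. 1 * int (g (m - r)))] (mod int p)"
    using alternating_choose_prime_minus_1_cong[OF p]
    by (intro cong_sum cong_scalar_right) (auto simp: pm)
  also have "(\<Sum>r\<le>m. 1 * int (g (m - r))) = (\<Sum>r\<le>m. int (g r))"
    using sum.nat_diff_reindex[of "\<lambda>r. int (g r)" "Suc m"] by (simp add: lessThan_Suc_atMost)
  finally have G_mid: "[G (e m) = (\<Sum>r\<le>m. int (g r))] (mod int p)" .

  \<comment> \<open>In this set \<open>e r\<close> has rank \<open>r\<close>, so the double count of
    choices evaluates the sum of all \<open>g r\<close> as \<open>k ^ p\<close>.\<close>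
  define K where "K = e ` {..m}"
  have e_inj_m: "inj_on e {..m}"
    by (auto simp: inj_on_def e_inj pm)
  have K: "K \<subseteq> H" "card K = p" "finite K" "K \<noteq> {}"
    using card_image[OF e_inj_m] by (auto simp: K_def eH pm)
  have "k ^ p = (\<Prod>i\<in>K. card (I i))"
    using K I by (simp add: subset_iff)
  also have "\<dots> = (\<Sum>b\<in>K. F (K - {b}) b)"
    unfolding F_def h_def using K I
    by (subst sum_first_choice_eq_prod_card) (auto intro: disjoint_family_on_mono)
  also have "\<dots> = (\<Sum>r\<le>m. F (K - {e r}) (e r))"
    unfolding K_def by (simp add: sum.reindex[OF e_inj_m])
  finally have kp: "k ^ p = (\<Sum>r\<le>m. F (K - {e r}) (e r))" .
  have "[int (F (K - {e r}) (e r)) = int (g r)] (mod int p)" if "r \<le> m" for r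
  proof -
    have "{x \<in> K. x < e r} = e ` {..<r}"
      using that by (auto simp: K_def e_less_iff pm)
    moreover have "inj_on e {..<r}"
      using that by (intro inj_on_subset[OF e_inj_m]) auto
    ultimately have "card {x \<in> K. x < e r} = r"
      by (simp add: card_image)
    moreover have "e r \<in> K"
      using that by (simp add: K_def)
    ultimately show ?thesis
      unfolding cong_int_iff using hom[of K "e r"] K by (simp add: F_def h_def)
  qed
  then have "[int (k ^ p) = (\<Sum>r\<le>m. int (g r))] (mod int p)"
    unfolding kp of_nat_sum by (intro cong_sum) auto
  then have "[int (k ^ p) = 0] (mod int p)"
    using G_mid G_eq G_last cong_trans cong_sym by blast
  then show ?thesis
    by (simp add: cong_0_iff flip: of_nat_power)
qed

section \<open>The colouring on the words of a copy\<close>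

definition positions :: "nat list \<Rightarrow> nat \<Rightarrow> nat set" where
  "positions w x = {i. i < length w \<and> w ! i = x}"

definition colour :: "nat \<Rightarrow> nat list \<Rightarrow> nat" where
  "colour p w = (\<Sum>q\<in>positions w 2. card {r \<in> positions w 1. q < r} ^ (p - 1)) mod p"

lemma mset_map_letters:
  assumes "A \<subseteq> {..<N}" "b \<in> {..<N} - A"
  shows "mset (map (\<lambda>j. if j \<in> A then x else if j = b then y else z) [0..<N]) =
    mset (replicate (card A) x @ y # replicate (N - Suc (card A)) z)"
proof -
  define C where "C = {..<N} - insert b A"
  have fin: "finite A" "finite C"
    using assms finite_subset by (auto simp: C_def)
  have "card (insert b A) = Suc (card A)"
    using fin assms by simp
  then have card_C: "card C = N - Suc (card A)"
    unfolding C_def using assms fin by (subst card_Diff_subset) auto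
  have "mset [0..<N] = mset_set (A \<union> insert b C)"
    using assms by (auto simp: C_def atLeast0LessThan intro!: arg_cong[where f = mset_set])
  also have "\<dots> = mset_set A + ({#b#} + mset_set C)"
    using fin assms by (subst mset_set_Union) (auto simp: C_def)
  finally have "mset (map (\<lambda>j. if j \<in> A then x else if j = b then y else z) [0..<N]) =
      image_mset (\<lambda>j. if j \<in> A then x else if j = b then y else z) (mset_set A + ({#b#} + mset_set C))"
    by (simp only: mset_map)
  also have "\<dots> = image_mset (\<lambda>_. x) (mset_set A) + ({#y#} + image_mset (\<lambda>_. z) (mset_set C))"
    using fin assms by (auto simp: C_def intro!: image_mset_cong arg_cong2[where f = plus] arg_cong2[where f = add_mset])
  also have "\<dots> = mset (replicate (card A) x @ y # replicate (N - Suc (card A)) z)"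
    using fin by (simp add: image_mset_const_eq card_C)
  finally show ?thesis .
qed

text \<open>The word has 1s on the blocks in \<open>A\<close>, 2s on block \<open>b\<close> and 3s
  on the other blocks. Only its 1s and 2s are described, since the colour sees nothing else.\<close>

lemma obtain_block_set_word:
  fixes n N :: nat and I :: "nat \<Rightarrow> nat set" and a :: "nat \<Rightarrow> nat"
  defines "E \<equiv> \<lambda>x. {i \<in> {..<n} - (\<Union>j<N. I j). a i = x}"
  assumes I: "\<And>j. j < N \<Longrightarrow> I j \<subseteq> {..<n}" "disjoint_family_on I {..<N}"
    and a: "\<And>i. i \<in> {..<n} - (\<Union>j<N. I j) \<Longrightarrow> a i \<in> {1..3}"
    and A: "A \<subseteq> {..<N}" "b \<in> {..<N} - A"
    and T: "T = replicate (card A) 1 @ 2 # replicate (N - Suc (card A)) 3"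
  obtains w where "w \<in> block_set 3 T n I a"
    "positions w 1 = E 1 \<union> (\<Union>j\<in>A. I j)" "positions w 2 = E 2 \<union> I b"
proof -
  define \<nu> where "\<nu> j = (if j \<in> A then 1 else if j = b then 2 else 3 :: nat)" for j
  define w where "w = map (\<lambda>i. if \<exists>j<N. i \<in> I j then \<nu> (THE j. j < N \<and> i \<in> I j) else a i) [0..<n]"
  have mset: "mset (map \<nu> [0..<N]) = mset T"
    unfolding T \<nu>_def by (rule mset_map_letters[OF A])
  then have length_T: "length T = N"
    by (metis length_map length_upt minus_nat.diff_0 size_mset)
  have the: "(THE j. j < N \<and> i \<in> I j) = j" if "j < N" "i \<in> I j" for i j
    using that I(2) by (intro the_equality) (auto simp: disjoint_family_on_def)
  have w_block: "w ! i = \<nu> j" if "j < N" "i \<in> I j" for i j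
  proof -
    have "i < n"
      using that I(1) by blast
    then show ?thesis
      using that unfolding w_def by (auto simp: the)
  qed
  have w_fixed: "w ! i = a i" if "i \<in> {..<n} - (\<Union>j<N. I j)" for i
    using that by (auto simp: w_def)
  have length_w: "length w = n"
    by (simp add: w_def)
  have "w ! i \<in> {1..3}" if "i < n" for i
  proof (cases "i \<in> (\<Union>j<N. I j)")
    case True
    then show ?thesis
      using w_block by (auto simp: \<nu>_def)
  next
    case False
    then show ?thesis
      using w_fixed[of i] a[of i] that by auto
  qed
  then have "w \<in> words 3 n"
    by (auto simp: words_def length_w in_set_conv_nth)
  moreover have "map \<nu> [0..<N] \<in> rearrangements 3 T"
    using mset by (auto simp: rearrangements_def words_def length_T \<nu>_def)
  ultimately have "w \<in> block_set 3 T n I a"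
    unfolding block_set_def length_T using w_fixed w_block
    by (auto intro!: bexI[of _ "map \<nu> [0..<N]"])
  moreover have pos: "positions w x = E x \<union> (\<Union>j\<in>{j. j < N \<and> \<nu> j = x}. I j)" for x
  proof (rule set_eqI)
    fix i
    show "i \<in> positions w x \<longleftrightarrow> i \<in> E x \<union> (\<Union>j\<in>{j. j < N \<and> \<nu> j = x}. I j)"
    proof (cases "i \<in> (\<Union>j<N. I j)")
      case True
      then obtain j where j: "j < N" "i \<in> I j"
        by auto
      have "j' = j" if "j' < N" "i \<in> I j'" for j'
        using the[OF j] the[OF that] by simp
      then have "i \<in> (\<Union>j\<in>{j. j < N \<and> \<nu> j = x}. I j) \<longleftrightarrow> \<nu> j = x"
        using j by blast
      moreover have "i \<in> positions w x \<longleftrightarrow> \<nu> j = x" "i \<notin> E x"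
        using j I(1)[of j] w_block[OF j] by (auto simp: positions_def length_w E_def)
      ultimately show ?thesis
        by blast
    next
      case False
      then show ?thesis
        using w_fixed[of i] by (auto simp: positions_def length_w E_def)
    qed
  qed
  moreover have "{j. j < N \<and> \<nu> j = 1} = A" "{j. j < N \<and> \<nu> j = 2} = {b}"
    using A by (auto simp: \<nu>_def split: if_splits)
  ultimately show thesis
    using that by (simp add: pos)
qed

text \<open>The words with the 2 in block \<open>b\<close> or in \<open>b'\<close> have the same 1s,
  so each position carries the same weight \<open>X q\<close> in both. The fixed 2s contribute
  equally to the two colours and cancel.\<close>

lemma monochromatic_block_set_cong:
  fixes n N :: nat and I :: "nat \<Rightarrow> nat set" and a :: "nat \<Rightarrow> nat"
  defines "c \<equiv> \<lambda>q. card {r \<in> {..<n} - (\<Union>j<N. I j). a r = 1 \<and> q < r}"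
  assumes I: "\<And>j. j < N \<Longrightarrow> I j \<subseteq> {..<n}" "disjoint_family_on I {..<N}"
    and a: "\<And>i. i \<in> {..<n} - (\<Union>j<N. I j) \<Longrightarrow> a i \<in> {1..3}"
    and T: "T = replicate (card A) 1 @ 2 # replicate (N - Suc (card A)) 3"
    and mono: "monochromatic (colour p) (block_set 3 T n I a)"
    and A: "A \<subseteq> {..<N}" "b \<in> {..<N} - A" "b' \<in> {..<N} - A"
  shows "[(\<Sum>q\<in>I b. (c q + (\<Sum>i\<in>A. card {r \<in> I i. q < r})) ^ (p - 1)) =
      (\<Sum>q\<in>I b'. (c q + (\<Sum>i\<in>A. card {r \<in> I i. q < r})) ^ (p - 1))] (mod p)"
proof -
  define E where "E x = {i \<in> {..<n} - (\<Union>j<N. I j). a i = x}" for x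
  define X where "X q = (c q + (\<Sum>i\<in>A. card {r \<in> I i. q < r})) ^ (p - 1)" for q
  have finI: "finite (I j)" if "j < N" for j
    using I(1)[OF that] finite_subset by blast
  have finA: "finite A"
    using A(1) finite_subset by blast
  have finE: "finite (E x)" for x
    by (simp add: E_def)
  have *: "card {r \<in> E 1 \<union> (\<Union>j\<in>A. I j). q < r} = c q + (\<Sum>i\<in>A. card {r \<in> I i. q < r})" for q
  proof -
    have "{r \<in> E 1 \<union> (\<Union>j\<in>A. I j). q < r} = {r \<in> E 1. q < r} \<union> (\<Union>j\<in>A. {r \<in> I j. q < r})"
      by auto
    also have "card \<dots> = card {r \<in> E 1. q < r} + card (\<Union>j\<in>A. {r \<in> I j. q < r})"
      using A(1) finA finI by (intro card_Un_disjoint) (auto simp: E_def)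
    also have "card (\<Union>j\<in>A. {r \<in> I j. q < r}) = (\<Sum>i\<in>A. card {r \<in> I i. q < r})"
    proof (rule card_UN_disjoint)
      show "\<forall>i\<in>A. \<forall>j\<in>A. i \<noteq> j \<longrightarrow> {r \<in> I i. q < r} \<inter> {r \<in> I j. q < r} = {}"
        using disjoint_family_on_mono[OF A(1) I(2)] unfolding disjoint_family_on_def by blast
    qed (use finA finI A(1) in auto)
    also have "card {r \<in> E 1. q < r} = c q"
      unfolding c_def E_def by (rule arg_cong[where f = card]) auto
    finally show ?thesis .
  qed
  have colour: "\<exists>w \<in> block_set 3 T n I a. colour p w = (sum X (E 2) + sum X (I x)) mod p"
    if x: "x \<in> {..<N} - A" for x
  proof -
    obtain w where w: "w \<in> block_set 3 T n I a"
      "positions w 1 = E 1 \<union> (\<Union>j\<in>A. I j)" "positions w 2 = E 2 \<union> I x"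
      by (rule obtain_block_set_word[OF I a A(1) x T]) (simp_all add: E_def)
    have "E 2 \<inter> I x = {}"
      using x by (auto simp: E_def)
    then have "colour p w = (sum X (E 2) + sum X (I x)) mod p"
      using x finI finE unfolding colour_def w(2,3) * X_def
      by (subst sum.union_disjoint) auto
    with w(1) show ?thesis
      by blast
  qed
  from colour[OF A(2)] colour[OF A(3)] mono
  have "[sum X (E 2) + sum X (I b) = sum X (E 2) + sum X (I b')] (mod p)"
    unfolding Defs.monochromatic_def cong_def by metis
  then show ?thesis
    unfolding X_def by (simp only: cong_add_lcancel_nat)
qed

theorem theorem2:
  fixes d :: nat
  assumes "d \<ge> 1"
  shows "\<exists>(T :: nat list) (r :: nat) (c :: nat list \<Rightarrow> nat).
           is_template 3 T \<and>
           c \<in> (\<Union>n\<in>{1..}. words 3 n) \<rightarrow> {..<r} \<and>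
           (\<forall>n\<ge>1. \<not> (\<exists>B k. is_block_set 3 T n k B \<and> k \<le> d \<and> monochromatic c B))"
proof -
  obtain p where p: "prime p" "d < p"
    using bigger_prime by blast
  obtain N where N: "\<And>F :: nat set \<Rightarrow> nat \<Rightarrow> nat. (\<And>K b. F K b < p) \<Longrightarrow>
      \<exists>H g. H \<subseteq> {..<N} \<and> card H = 2 * p \<and>
        (\<forall>K b. K \<subseteq> H \<longrightarrow> card K = p \<longrightarrow> b \<in> K \<longrightarrow> F K b = g (card {x \<in> K. x < b}))"
    using ramsey_rank[of p "2 * p" p] by blast
  have "0 < p"
    using p by simp
  \<comment> \<open>Any \<open>F\<close> at all yields a set of \<open>2 * p\<close> indices below
    \<open>N\<close>, so the zero function suffices.\<close>
  have "2 * p \<le> N"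
    using N[of "\<lambda>_ _. 0"] \<open>0 < p\<close> by (metis card_lessThan card_mono finite_lessThan)
  define T :: "nat list" where "T = replicate (p - 1) 1 @ 2 # replicate (N - p) 3"
  have length_T: "length T = N"
    using \<open>2 * p \<le> N\<close> \<open>0 < p\<close> by (simp add: T_def)
  have "is_template 3 T"
    unfolding is_template_def
  proof
    show "\<exists>l\<ge>1. T \<in> words 3 l"
      by (rule exI[of _ "length T"]) (auto simp: words_def T_def)
    show "sorted T"
      by (auto simp: T_def sorted_append)
  qed
  moreover have "colour p \<in> (\<Union>n\<in>{1..}. words 3 n) \<rightarrow> {..<p}"
    using \<open>0 < p\<close> by (simp add: colour_def)
  moreover have False if B: "is_block_set 3 T n k B" "k \<le> d" "monochromatic (colour p) B" for n k B
  proof -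
    from B(1) obtain I a where blocks: "\<forall>j<N. I j \<subseteq> {..<n} \<and> I j \<noteq> {} \<and> card (I j) = k"
      and disj: "disjoint_family_on I {..<N}"
      and a: "\<forall>i \<in> {..<n} - (\<Union>j<N. I j). a i \<in> {1..3}"
      and B_eq: "B = block_set 3 T n I a"
      unfolding is_block_set_def length_T by (elim exE conjE)
    have I: "I j \<subseteq> {..<n}" "I j \<noteq> {}" "card (I j) = k" if "j < N" for j
      using blocks that by auto
    have finI: "finite (I j)" if "j < N" for j
      using I(1)[OF that] finite_subset by blast
    obtain H g where H: "H \<subseteq> {..<N}" "card H = 2 * p"
      and hom: "\<And>K b. \<lbrakk>K \<subseteq> H; card K = p; b \<in> K\<rbrakk> \<Longrightarrow>
        (\<Sum>q\<in>I b. \<Prod>i\<in>K - {b}. card {r \<in> I i. q < r}) mod p = g (card {x \<in> K. x < b})"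
      \<comment> \<open>Reducing modulo \<open>p\<close> gives the bounded values that Ramsey's
        theorem requires.\<close>
      using N[of "\<lambda>K b. (\<Sum>q\<in>I b. \<Prod>i\<in>K - {b}. card {r \<in> I i. q < r}) mod p"] \<open>0 < p\<close>
      by auto
    have "p dvd k ^ p"
    proof (rule prime_dvd_block_size_power[OF p(1) H(2)])
      show "disjoint_family_on I H"
        using disj H(1) by (rule disjoint_family_on_mono[rotated])
      show "[(\<Sum>q\<in>I b. \<Prod>i\<in>K - {b}. card {r \<in> I i. q < r}) = g (card {x \<in> K. x < b})] (mod p)"
        if "K \<subseteq> H" "card K = p" "b \<in> K" for K b
        unfolding hom[OF that, symmetric] by (simp add: cong_def)
      show "[(\<Sum>q\<in>I b. (card {r \<in> {..<n} - (\<Union>j<N. I j). a r = 1 \<and> q < r} +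
            (\<Sum>i\<in>A. card {r \<in> I i. q < r})) ^ (p - 1)) =
          (\<Sum>q\<in>I b'. (card {r \<in> {..<n} - (\<Union>j<N. I j). a r = 1 \<and> q < r} +
            (\<Sum>i\<in>A. card {r \<in> I i. q < r})) ^ (p - 1))] (mod p)"
        if "A \<subseteq> H" "card A = p - 1" "b \<in> H - A" "b' \<in> H - A" for A b b'
        using that H(1) B(3) \<open>0 < p\<close>
        by (intro monochromatic_block_set_cong[where T = T] I(1) disj bspec[OF a]) (auto simp: T_def B_eq)
    qed (use finI I(3) H(1) in auto)
    then have "p dvd k"
      using p(1) prime_dvd_power by blast
    moreover have "0 < k"
      using I(2,3)[of 0] finI[of 0] \<open>2 * p \<le> N\<close> \<open>0 < p\<close> by (auto simp: card_gt_0_iff)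
    ultimately show False
      using B(2) p(2) by (auto dest: dvd_imp_le)
  qed
  ultimately show ?thesis
    by blast
qed

end
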